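(* Let $n,k\ge 1$ and let ${\bf C}=(C_0,C_1,\dots,C_k)$ be a $(k+1)$-tuple of real $n\times n$ matrices such that $C_0$ is invertible and $C_0^{-1}C_i$ is a $Z$-matrix for every $i\in\{1,\dots,k\}$. Then the following statements are equivalent: (i) ${\bf C}$ has the $\mathbf{SSM}$-$W$ property. (ii) For all $q\in\mathbb{R}^n$ and all ${\bf d}\in(\mathbb{R}^n_{++})^{k-1}$, $\mathrm{EHLCP}({\bf C},{\bf d},q)$ has a unique solution.
   Context: Notation: $\mathbb{R}^n_{++}$ is the set of vectors in $\mathbb{R}^n$ with all entries positive; $x\wedge y$ is the componentwise minimum and $x*y$ the Hadamard (componentwise) product of $x,y\in\mathbb{R}^n$; inequalities between vectors are componentwise. A real square matrix is a $Z$-matrix if all its off-diagonal entries are non-positive. Extended horizontal linear complementarity problem: given ${\bf C}=(C_0,\dots,C_k)$ with $C_i\in\mathbb{R}^{n\times n}$, $q\in\mathbb{R}^n$ and ${\bf d}=(d_1,\dots,d_{k-1})\in(\mathbb{R}^n_{++})^{k-1}$ (empty if $k=1$), $\mathrm{EHLCP}({\bf C},{\bf d},q)$ asks for $(x_0,x_1,\dots,x_k)\in(\mathbb{R}^n)^{k+1}$ with $$C_0x_0=q+\sum_{i=1}^k C_ix_i,\qquad x_0\wedge x_1=0,\qquad (d_j-x_j)\wedge x_{j+1}=0\ \ (1\le j\le k-1).$$ ${\bf C}$ has the $\mathbf{SSM}$-$W$ property if, for all $x_0,x_1,\dots,x_k\in\mathbb{R}^n$, the conditions $C_0x_0=\sum_{i=1}^kC_ix_i$,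 $x_i\ge 0$ and $x_0*x_i\le 0$ for all $i\in\{1,\dots,k\}$ imply $x_0=x_1=\dots=x_k=0$. (No sign condition is imposed on $x_0$.) *)

theory Defs
  imports "HOL-Analysis.Analysis"
begin

text \<open>
  A tuple \<open>(C\<^sub>0, \<dots>, C\<^sub>k)\<close> is given by \<open>k\<close> and a function \<open>C\<close> on the naturals of which only the
  values at \<open>0, \<dots>, k\<close> are used; likewise \<open>d\<close> is used only at \<open>1, \<dots>, k - 1\<close>.
  On \<open>real ^ 'n\<close> the library's \<open>\<le>\<close>, \<open>inf\<close> and \<open>*\<close> are the componentwise order, the componentwise
  minimum and the Hadamard product.
\<close>

definition Z_matrix :: "real ^ 'n ^ 'n \<Rightarrow> bool" where
  "Z_matrix A \<longleftrightarrow> (\<forall>i j. i \<noteq> j \<longrightarrow> A $ i $ j \<le> 0)"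

text \<open>The library's strict order \<open><\<close> on vectors does not mean strict in every component,
  so positivity is spelled out.\<close>

definition pos_vec :: "real ^ 'n \<Rightarrow> bool" where
  "pos_vec v \<longleftrightarrow> (\<forall>i. 0 < v $ i)"

definition SSM_W :: "nat \<Rightarrow> (nat \<Rightarrow> real ^ 'n ^ 'n) \<Rightarrow> bool" where
  "SSM_W k C \<longleftrightarrow>
    (\<forall>x :: nat \<Rightarrow> real ^ 'n.
      C 0 *v x 0 = (\<Sum>i = 1..k. C i *v x i) \<and>
      (\<forall>i \<in> {1..k}. 0 \<le> x i \<and> x 0 * x i \<le> 0)
      \<longrightarrow> (\<forall>i \<in> {0..k}. x i = 0))"

text \<open>A solution \<open>(x\<^sub>0, \<dots>, x\<^sub>k)\<close> is an extensional function on \<open>{0..k}\<close>, so that equality of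
  solutions is equality of \<open>(k+1)\<close>-tuples.\<close>

definition EHLCP ::
  "nat \<Rightarrow> (nat \<Rightarrow> real ^ 'n ^ 'n) \<Rightarrow> (nat \<Rightarrow> real ^ 'n) \<Rightarrow> real ^ 'n \<Rightarrow> (nat \<Rightarrow> real ^ 'n) set" where
  "EHLCP k C d q =
    {x \<in> {0..k} \<rightarrow>\<^sub>E UNIV.
      C 0 *v x 0 = q + (\<Sum>i = 1..k. C i *v x i) \<and>
      inf (x 0) (x 1) = 0 \<and>
      (\<forall>j \<in> {1..<k}. inf (d j - x j) (x (j + 1)) = 0)}"

end

theory Submission
  imports Defs
begin

text \<open>
  Multiplying by the inverse of \<open>C\<^sub>0\<close> turns \<open>C\<^sub>0\<close> into the identity and \<open>C\<^sub>i\<close> into a \<open>Z\<close>-matrix \<open>M\<^sub>i\<close>.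
  The solutions then correspond to the zeros \<open>t\<close> of \<open>G + q\<close> for a continuous map \<open>G\<close> (\<open>residual\<close> below)
  whose \<open>j\<close>-th component is antitone in the variables other than \<open>t\<^sub>j\<close>, by the \<open>Z\<close>-property; such an
  equation is solvable between a subsolution and a supersolution.
  Under \<open>SSM-W\<close>, a positive \<open>u\<close> with \<open>M\<^sub>k u > 0\<close> yields supersolutions, and the positive part of the
  difference of two solutions is a test vector for \<open>SSM-W\<close>, hence zero.
  Conversely, uniqueness makes \<open>G\<close> inverse isotone. If \<open>A\<close> takes each of its columns from one of the
  \<open>M\<^sub>i\<close>, then \<open>G\<close> has slope \<open>A\<close> along suitable segments, so \<open>A\<close> is a nonsingular \<open>M\<close>-matrix. This persists
  under columnwise convex combination, and a vector violating \<open>SSM-W\<close> violates it for such a combination.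
\<close>

section \<open>Nonsingular M-matrices among the Z-matrices\<close>

definition semipositive :: "real ^ 'n ^ 'n \<Rightarrow> bool" where
  "semipositive A \<longleftrightarrow> (\<exists>u. pos_vec u \<and> pos_vec (A *v u))"

text \<open>On Z-matrices this and \<open>semipositive\<close> both characterize nonsingular
  M-matrices. This form is what \<open>SSM_W\<close> and uniqueness yield; the other one survives
  mixing of columns.\<close>

definition no_nonneg_descent :: "real ^ 'n ^ 'n \<Rightarrow> bool" where
  "no_nonneg_descent A \<longleftrightarrow> (\<forall>s. 0 \<le> s \<longrightarrow> A *v s \<le> 0 \<longrightarrow> s = 0)"

lemma Z_matrix_mult_nonpos:
  assumes "Z_matrix A" "0 \<le> y" "y $ j = 0"
  shows "(A *v y) $ j \<le> 0"
  unfolding matrix_vector_mult_def vec_lambda_beta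
proof (rule sum_nonpos)
  fix l
  show "A $ j $ l * y $ l \<le> 0"
    using assms by (cases "l = j") (auto simp: Z_matrix_def less_eq_vec_def mult_nonpos_nonneg)
qed

text \<open>The negative part \<open>y\<close> of \<open>x\<close> satisfies
  \<open>A *v y \<le> 0\<close>: where \<open>y\<close> vanishes by the Z-property, elsewhere
  because the positive part \<open>z\<close> vanishes there and
  \<open>A *v y = A *v z - A *v x\<close>.\<close>

lemma no_nonneg_descent_monotone:
  assumes Z: "Z_matrix A" and E: "no_nonneg_descent A" and Ax: "0 \<le> A *v x"
  shows "0 \<le> x"
proof -
  define y where "y = (\<chi> j. max 0 (- x $ j))"
  define z where "z = (\<chi> j. max 0 (x $ j))"
  have nn: "0 \<le> y" "0 \<le> z" by (auto simp: y_def z_def less_eq_vec_def)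
  have "x = z - y" by (auto simp: vec_eq_iff y_def z_def)
  then have eq: "A *v y = A *v z - A *v x"
    by (simp add: matrix_vector_mult_diff_distrib)
  have "A *v y \<le> 0"
    unfolding less_eq_vec_def
  proof
    fix j
    show "(A *v y) $ j \<le> 0 $ j"
    proof (cases "y $ j = 0")
      case True
      then show ?thesis using Z_matrix_mult_nonpos[OF Z nn(1)] by simp
    next
      case False
      then have "z $ j = 0" by (auto simp: y_def z_def)
      then have "(A *v z) $ j \<le> 0" using Z_matrix_mult_nonpos[OF Z nn(2)] by simp
      moreover have "0 \<le> (A *v x) $ j" using Ax by (simp add: less_eq_vec_def)
      ultimately show ?thesis by (simp add: eq)
    qed
  qed
  then have "y = 0" using E nn by (auto simp: no_nonneg_descent_def)
  then have y0: "max 0 (- x $ j) = 0" for j by (simp add: y_def vec_eq_iff)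
  have "0 \<le> x $ j" for j using y0[of j] by linarith
  then show ?thesis by (simp add: less_eq_vec_def)
qed

text \<open>Monotonicity makes \<open>A\<close> injective, hence surjective. The preimage of the
  all-ones vector is nonnegative, and the Z-property rules out a zero entry.\<close>

lemma no_nonneg_descent_imp_semipositive:
  assumes Z: "Z_matrix A" and E: "no_nonneg_descent A"
  shows "semipositive A"
proof -
  have "inj ((*v) A)"
  proof (rule injI)
    fix x y assume eq: "A *v x = A *v y"
    have "0 \<le> x - y" "0 \<le> y - x"
      by (rule no_nonneg_descent_monotone[OF Z E]; simp add: matrix_vector_mult_diff_distrib eq)+
    then show "x = y" by (auto intro!: antisym simp: less_eq_vec_def vec_eq_iff)
  qed
  then have "surj ((*v) A)"
    using matrix_vector_mul_linear linear_injective_imp_surjective by blast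
  then obtain u where u: "A *v u = vec 1" by (metis surjD)
  have "0 \<le> u"
    by (rule no_nonneg_descent_monotone[OF Z E]) (simp add: u less_eq_vec_def)
  moreover have "u $ j \<noteq> 0" for j
    using Z_matrix_mult_nonpos[OF Z \<open>0 \<le> u\<close>, of j] u by auto
  ultimately have "pos_vec u"
    by (auto simp: pos_vec_def less_eq_vec_def less_le)
  then show ?thesis using u by (auto simp: semipositive_def pos_vec_def)
qed

text \<open>Take the multiple of \<open>u\<close> that touches \<open>s\<close> from above. At the
  touching index \<open>l\<close> the Z-property bounds \<open>\<theta> * (A *v u) $ l\<close> by
  \<open>(A *v s) $ l\<close>, so \<open>\<theta> \<le> 0\<close>.\<close>

lemma semipositive_imp_no_nonneg_descent:
  assumes Z: "Z_matrix A" and S: "semipositive A"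
  shows "no_nonneg_descent A"
  unfolding no_nonneg_descent_def
proof (intro allI impI)
  fix s :: "real ^ 'a" assume s: "0 \<le> s" "A *v s \<le> 0"
  obtain u where u: "\<And>j. 0 < u $ j" "\<And>j. 0 < (A *v u) $ j"
    using S by (auto simp: semipositive_def pos_vec_def)
  define \<theta> where "\<theta> = Max (range (\<lambda>j. s $ j / u $ j))"
  have "\<theta> \<in> range (\<lambda>j. s $ j / u $ j)" unfolding \<theta>_def by (rule Max_in) auto
  then obtain l where l: "\<theta> = s $ l / u $ l" by auto
  have le: "s $ j \<le> \<theta> * u $ j" for j
  proof -
    have "s $ j / u $ j \<le> \<theta>" unfolding \<theta>_def by (rule Max_ge) auto
    then show ?thesis using u(1)[of j] by (simp add: pos_divide_le_eq)
  qed
  have "(A *v (\<theta> *\<^sub>R u - s)) $ l \<le> 0"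
  proof (rule Z_matrix_mult_nonpos[OF Z])
    show "0 \<le> \<theta> *\<^sub>R u - s" using le by (simp add: less_eq_vec_def)
    show "(\<theta> *\<^sub>R u - s) $ l = 0" using l u(1)[of l] by (simp add: field_simps)
  qed
  then have "\<theta> * (A *v u) $ l \<le> (A *v s) $ l"
    by (simp add: matrix_vector_mult_diff_distrib matrix_vector_mult_scaleR)
  also have "\<dots> \<le> 0" using s by (simp add: less_eq_vec_def)
  finally have "\<theta> \<le> 0" using u(2)[of l] by (simp add: mult_le_0_iff)
  have "s $ j = 0" for j
  proof -
    have "s $ j \<le> 0"
      using le[of j] u(1)[of j] \<open>\<theta> \<le> 0\<close> by (smt (verit) mult_nonpos_nonneg)
    then show ?thesis using s by (auto simp: less_eq_vec_def intro: antisym)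
  qed
  then show "s = 0" by (simp add: vec_eq_iff)
qed

text \<open>A positive vector for each choice of column \<open>j\<^sub>0\<close>, scaled so that its entry at \<open>j\<^sub>0\<close> is
  the weight of that choice, sums to a positive vector for the mixed column.\<close>

lemma semipositive_column_mixture:
  fixes M :: "nat \<Rightarrow> real ^ 'n ^ 'n"
  assumes I: "finite I"
    and w: "\<And>i j. i \<in> I \<Longrightarrow> 0 \<le> w i j" "\<And>j. (\<Sum>i\<in>I. w i j) = 1"
    and S: "\<And>\<sigma>. range \<sigma> \<subseteq> I \<Longrightarrow> semipositive (\<chi> r j. M (\<sigma> j) $ r $ j)"
  shows "semipositive (\<chi> r j. \<Sum>i\<in>I. w i j * M i $ r $ j)"
proof -
  \<comment> \<open>Induction on the set \<open>J\<close> of columns already mixed;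
    \<open>\<sigma>\<close> varies because the hypothesis is used at
    \<open>\<sigma>(j0 := i)\<close> for every \<open>i\<close>.\<close>
  have *: "range \<sigma> \<subseteq> I \<Longrightarrow>
      semipositive (\<chi> r j. if j \<in> J then \<Sum>i\<in>I. w i j * M i $ r $ j else M (\<sigma> j) $ r $ j)"
    if "finite J" for J \<sigma>
    using that
  proof (induction J arbitrary: \<sigma>)
    case empty
    then show ?case using S by simp
  next
    case (insert j0 J)
    define A where "A = (\<lambda>i. \<chi> r j. if j \<in> J then \<Sum>i\<in>I. w i j * M i $ r $ j
        else M ((\<sigma>(j0 := i)) j) $ r $ j)"
    define B where "B = (\<chi> r j. if j \<in> insert j0 J then \<Sum>i\<in>I. w i j * M i $ r $ j
        else M (\<sigma> j) $ r $ j)"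
    have "\<exists>u. \<forall>i\<in>I. pos_vec (u i) \<and> pos_vec (A i *v u i)"
    proof (rule bchoice, rule ballI)
      fix i assume "i \<in> I"
      then have "semipositive (A i)"
        unfolding A_def using insert.prems by (intro insert.IH) auto
      then show "\<exists>u. pos_vec u \<and> pos_vec (A i *v u)" by (simp add: semipositive_def)
    qed
    then obtain u where u: "\<And>i l. i \<in> I \<Longrightarrow> 0 < u i $ l" "\<And>i r. i \<in> I \<Longrightarrow> 0 < (A i *v u i) $ r"
      by (auto simp: pos_vec_def)
    define c where "c = (\<lambda>i. w i j0 / u i $ j0)"
    define v where "v = (\<Sum>i\<in>I. c i *\<^sub>R u i)"
    have c: "0 \<le> c i" if "i \<in> I" for i
      using w(1) u(1) that by (simp add: c_def less_imp_le)
    \<comment> \<open>One positive coefficient is enough for the strict inequalities below.\<close>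
    obtain i0 where i0: "i0 \<in> I" "0 < c i0"
    proof -
      have "\<exists>i\<in>I. w i j0 \<noteq> 0"
        using w(2)[of j0] by (metis sum.neutral zero_neq_one)
      then obtain i where "i \<in> I" "0 < w i j0" using w(1) by (metis less_le)
      then show ?thesis using that u(1) by (auto simp: c_def)
    qed
    have pos: "0 < (\<Sum>i\<in>I. c i * f i)" if "\<And>i. i \<in> I \<Longrightarrow> 0 < f i" for f
      using i0 that c by (intro sum_pos2[OF I i0(1)]) (auto simp: less_imp_le)
    have "pos_vec v"
      using pos u(1) by (auto simp: pos_vec_def v_def)
    moreover have "pos_vec (B *v v)"
      unfolding pos_vec_def
    proof
      fix r
      \<comment> \<open>\<open>A i\<close> and \<open>B\<close> differ only in column
        \<open>j0\<close>, where \<open>v\<close> is 1 and the scaled columns add up to the mixed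
        one.\<close>
      have col: "B $ r $ l * v $ l = (\<Sum>i\<in>I. c i * (A i $ r $ l * u i $ l))" for l
      proof (cases "l = j0")
        case True
        have "v $ j0 = 1"
          using u(1) w(2)[of j0] unfolding v_def c_def
          by (simp add: less_imp_neq[symmetric] cong: sum.cong)
        moreover have "c i * (A i $ r $ j0 * u i $ j0) = w i j0 * M i $ r $ j0" if "i \<in> I" for i
          using u(1)[OF that, of j0] insert.hyps by (simp add: c_def A_def)
        ultimately show ?thesis using True by (simp add: B_def)
      next
        case False
        then have "A i $ r $ l = B $ r $ l" for i by (simp add: A_def B_def)
        then show ?thesis by (simp add: v_def sum_distrib_left mult_ac)
      qed
      have "(B *v v) $ r = (\<Sum>i\<in>I. c i * (A i *v u i) $ r)"
        unfolding matrix_vector_mult_def vec_lambda_beta col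
        by (subst sum.swap) (simp add: sum_distrib_left)
      then show "0 < (B *v v) $ r" using pos u(2) by simp
    qed
    ultimately show ?case unfolding semipositive_def B_def by blast
  qed
  have "I \<noteq> {}" using w(2) by force
  then obtain i where "i \<in> I" by blast
  then show ?thesis using *[of UNIV "\<lambda>_. i"] by auto
qed

section \<open>Solutions between a subsolution and a supersolution\<close>

text \<open>Brouwer's theorem for \<open>t - (G t - p)\<close> clipped to the box. Where clipping is
  active, the fixed point lies on a face, and antitonicity with the bound at \<open>a\<close> or
  \<open>b\<close> still forces equality in that coordinate.\<close>

lemma offdiag_antitone_box_solution:
  fixes G :: "real ^ 'n \<Rightarrow> real ^ 'n"
  assumes cont: "continuous_on UNIV G"
    and anti: "\<And>t u j. t \<le> u \<Longrightarrow> t $ j = u $ j \<Longrightarrow> G u $ j \<le> G t $ j"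
    and ab: "a \<le> b" and sub: "G a \<le> p" and super: "p \<le> G b"
  obtains t where "a \<le> t" "t \<le> b" "G t = p"
proof -
  define f where "f t = (\<chi> j. max (a $ j) (min (b $ j) (t $ j - (G t $ j - p $ j))))" for t
  have ab': "a $ j \<le> b $ j" for j using ab by (simp add: less_eq_vec_def)
  have "continuous_on (cbox a b) f"
    unfolding f_def
    by (intro continuous_intros continuous_on_subset[OF cont] continuous_on_component) auto
  moreover have "f ` cbox a b \<subseteq> cbox a b"
    using ab' by (auto simp: f_def mem_box_cart)
  moreover have "cbox a b \<noteq> {}" using ab' by (auto simp: interval_ne_empty_cart)
  ultimately obtain t where t: "t \<in> cbox a b" "f t = t"
    using brouwer[of "cbox a b" f] by (metis compact_cbox convex_box(1) image_subset_iff_funcset)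
  then have le: "a \<le> t" "t \<le> b" by (auto simp: mem_box_cart less_eq_vec_def)
  have "G t $ j = p $ j" for j
  proof -
    have ft: "max (a $ j) (min (b $ j) (t $ j - (G t $ j - p $ j))) = t $ j"
      using t(2) by (simp add: f_def vec_eq_iff)
    have "p $ j \<le> G t $ j" if "t $ j = b $ j"
      using anti[OF le(2) that] super by (auto simp: less_eq_vec_def intro: order_trans)
    moreover have "G t $ j \<le> p $ j" if "t $ j = a $ j"
      using anti[OF le(1) that[symmetric]] sub by (auto simp: less_eq_vec_def intro: order_trans)
    ultimately show ?thesis using ft ab'[of j] by (auto simp: max_def min_def split: if_splits)
  qed
  then show ?thesis using that le by (simp add: vec_eq_iff)
qed

section \<open>Complementarity chains in one coordinate\<close>

text \<open>One coordinate of a solution is determined by \<open>t = x\<^sub>1 + \<dots> + x\<^sub>k - x\<^sub>0\<close>: the mass \<open>t\<close>, if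
  positive, fills \<open>x\<^sub>1, x\<^sub>2, \<dots>\<close> up to their capacities \<open>d\<^sub>1, d\<^sub>2, \<dots>\<close> in this order.\<close>

definition fill :: "nat \<Rightarrow> (nat \<Rightarrow> real) \<Rightarrow> nat \<Rightarrow> real \<Rightarrow> real" where
  "fill k d i t =
    (if i = 0 then max 0 (- t)
     else if i < k then max 0 (min (t - sum d {1..<i}) (d i))
     else max 0 (t - sum d {1..<i}))"

lemma fill_mono: "i \<ge> 1 \<Longrightarrow> t \<le> u \<Longrightarrow> fill k d i t \<le> fill k d i u"
  by (auto simp: fill_def max_def min_def)

lemma continuous_on_fill [continuous_intros]:
  "continuous_on S f \<Longrightarrow> continuous_on S (\<lambda>x. fill k d i (f x))"
  unfolding fill_def by (cases "i = 0"; cases "i < k") (auto intro!: continuous_intros)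

lemma fill_complementary:
  assumes "k \<ge> 1" "\<And>i. i \<in> {1..<k} \<Longrightarrow> 0 < d i"
  shows "inf (fill k d 0 t) (fill k d 1 t) = 0"
    and "j \<in> {1..<k} \<Longrightarrow> inf (d j - fill k d j t) (fill k d (j + 1) t) = 0"
proof -
  show "inf (fill k d 0 t) (fill k d 1 t) = 0"
    using assms(2)[of 1] by (auto simp: fill_def inf_min max_def min_def)
  assume j: "j \<in> {1..<k}"
  then have "sum d {1..<j + 1} = sum d {1..<j} + d j" by simp
  then show "inf (d j - fill k d j t) (fill k d (j + 1) t) = 0"
    using j assms(2)[of j] assms(2)[of "j + 1"]
    by (auto simp: fill_def inf_min max_def min_def)
qed

text \<open>Recovers \<open>t\<close> from its slots, so that equal solutions have equal
  parameters.\<close>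

lemma fill_sum:
  assumes "k \<ge> 1" "\<And>i. i \<in> {1..<k} \<Longrightarrow> 0 < d i"
  shows "(\<Sum>i = 1..k. fill k d i t) - fill k d 0 t = t"
proof -
  have nn: "0 \<le> sum d {1..<m}" if "m \<le> k" for m
    using assms(2) that by (intro sum_nonneg) (auto simp: less_imp_le)
  \<comment> \<open>The slots below \<open>m\<close> hold \<open>t\<close> clipped between 0 and
    their total capacity; slot \<open>k\<close>, which has no capacity, takes the rest.\<close>
  have *: "(\<Sum>i = 1..<m. fill k d i t) = max 0 (min t (sum d {1..<m}))" if "m \<ge> 1" "m \<le> k" for m
    using that
  proof (induction m rule: nat_induct_at_least)
    case base
    then show ?case by simp
  next
    case (Suc m)
    then show ?case
      using assms(2)[of m] nn[of m] by (auto simp: fill_def max_def min_def)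
  qed
  have "(\<Sum>i = 1..k. fill k d i t) = (\<Sum>i = 1..<k. fill k d i t) + fill k d k t"
    using assms(1) by (simp add: sum.last_plus add.commute)
  then show ?thesis
    using *[of k] nn[of k] assms(1) by (auto simp: fill_def max_def min_def)
qed

text \<open>A slot is nonempty only if all earlier ones are full. Since \<open>x' i\<close> is
  positive, \<open>x'\<close> is full below \<open>i\<close> and \<open>x' 0 = 0\<close>; since
  \<open>x i\<close> stays below capacity, \<open>x\<close> is empty above \<open>i\<close>. Hence
  two chains are always comparable.\<close>

lemma complementary_chain_comparison:
  fixes x x' d :: "nat \<Rightarrow> real"
  assumes d: "\<And>i. i \<in> {1..<k} \<Longrightarrow> 0 < d i"
    and x: "inf (x 0) (x 1) = 0" "\<And>j. j \<in> {1..<k} \<Longrightarrow> inf (d j - x j) (x (j + 1)) = 0"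
    and x': "inf (x' 0) (x' 1) = 0" "\<And>j. j \<in> {1..<k} \<Longrightarrow> inf (d j - x' j) (x' (j + 1)) = 0"
    and i: "i \<in> {1..k}" "x i < x' i"
  shows "m \<in> {1..k} \<Longrightarrow> x m \<le> x' m" and "x' 0 \<le> x 0"
proof -
  have inf_eq: "inf a b = 0 \<longleftrightarrow> 0 \<le> a \<and> 0 \<le> b \<and> (a = 0 \<or> b = 0)" for a b :: real
    by (auto simp: inf_min min_def)
  note x = x[unfolded inf_eq] and x' = x'[unfolded inf_eq]
  have nn: "0 \<le> x m" "0 \<le> x' m" if "m \<in> {1..k}" for m
  proof -
    have "0 \<le> x m \<and> 0 \<le> x' m"
    proof (cases "m = 1")
      case True
      then show ?thesis using x(1) x'(1) by simp
    next
      case False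
      then have "m = (m - 1) + 1" "m - 1 \<in> {1..<k}" using that by auto
      then show ?thesis using x(2)[of "m - 1"] x'(2)[of "m - 1"] by metis
    qed
    then show "0 \<le> x m" "0 \<le> x' m" by auto
  qed
  have below: "x m \<le> x' m \<and> 0 < x' m" if "m \<le> i" "1 \<le> m" for m
    using that
  proof (induction m rule: inc_induct)
    case base
    then show ?case using i nn[of i] by simp
  next
    case (step m)
    then show ?case using x(2)[of m] x'(2)[of m] d[of m] i by auto
  qed
  have above: "x m = 0" if "i + 1 \<le> m" "m \<le> k" for m
    using that
  proof (induction m rule: dec_induct)
    case base
    then show ?case using x(2)[of i] x'(2)[of i] i by auto
  next
    case (step m)
    then show ?case using x(2)[of m] d[of m] by auto
  qed
  show "x m \<le> x' m" if "m \<in> {1..k}"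
    using that below[of m] above[of m] nn[of m] by (cases "m \<le> i") auto
  show "x' 0 \<le> x 0" using below[of 1] i x(1) x'(1) by auto
qed

section \<open>Reduction to a nonlinear equation in \<open>t\<close>\<close>

definition vfill :: "nat \<Rightarrow> (nat \<Rightarrow> real ^ 'n) \<Rightarrow> nat \<Rightarrow> real ^ 'n \<Rightarrow> real ^ 'n" where
  "vfill k d i t = (\<chi> j. fill k (\<lambda>m. d m $ j) i (t $ j))"

text \<open>With \<open>M 0 = mat 1\<close> and \<open>x i = vfill k d i t\<close>, the linear
  equation of the problem reads \<open>residual k M d t = - q\<close>.\<close>

definition residual :: "nat \<Rightarrow> (nat \<Rightarrow> real ^ 'n ^ 'n) \<Rightarrow> (nat \<Rightarrow> real ^ 'n) \<Rightarrow> real ^ 'n \<Rightarrow> real ^ 'n" where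
  "residual k M d t = (\<Sum>i = 1..k. M i *v vfill k d i t) - vfill k d 0 t"

lemma vfill_sum:
  assumes "k \<ge> 1" "\<And>i. i \<in> {1..<k} \<Longrightarrow> pos_vec (d i)"
  shows "(\<Sum>i = 1..k. vfill k d i t) - vfill k d 0 t = t"
  using fill_sum[OF assms(1)] assms(2) by (simp add: vec_eq_iff vfill_def pos_vec_def)

lemma vfill_EHLCP:
  assumes "M 0 = mat 1" "k \<ge> 1" "\<And>i. i \<in> {1..<k} \<Longrightarrow> pos_vec (d i)" "residual k M d t = - q"
  shows "restrict (\<lambda>i. vfill k d i t) {0..k} \<in> EHLCP k M d q"
proof -
  have "inf (vfill k d 0 t) (vfill k d 1 t) = 0"
    using fill_complementary(1)[OF assms(2)] assms(3)
    by (simp add: vec_eq_iff vfill_def pos_vec_def inf_vec_def)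
  moreover have "inf (d j - vfill k d j t) (vfill k d (j + 1) t) = 0" if "j \<in> {1..<k}" for j
    using fill_complementary(2)[of k "\<lambda>m. d m $ i" j "t $ i" for i] assms(2,3) that
    by (simp add: vec_eq_iff vfill_def pos_vec_def inf_vec_def)
  moreover have "vfill k d 0 t = q + (\<Sum>i = 1..k. M i *v vfill k d i t)"
    using assms(4) by (simp add: residual_def algebra_simps eq_neg_iff_add_eq_0)
  ultimately show ?thesis
    using assms(1,2) by (simp add: EHLCP_def)
qed

lemma continuous_on_residual: "continuous_on UNIV (residual k M d)"
  unfolding residual_def vfill_def matrix_vector_mult_def
  by (auto intro!: continuous_intros continuous_on_component)

text \<open>Entries other than \<open>j\<close> of the slots grow with \<open>t\<close> and meet
  nonpositive coefficients in row \<open>j\<close>; entry \<open>j\<close> of every slot is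
  unchanged.\<close>

lemma residual_antitone:
  assumes "\<And>i. i \<in> {1..k} \<Longrightarrow> Z_matrix (M i)" "t \<le> u" "t $ j = u $ j"
  shows "residual k M d u $ j \<le> residual k M d t $ j"
proof -
  have "(M i *v vfill k d i u) $ j \<le> (M i *v vfill k d i t) $ j" if "i \<in> {1..k}" for i
    unfolding matrix_vector_mult_def vec_lambda_beta
  proof (rule sum_mono)
    fix l
    show "M i $ j $ l * vfill k d i u $ l \<le> M i $ j $ l * vfill k d i t $ l"
      using assms that
      by (cases "l = j")
        (auto simp: vfill_def Z_matrix_def less_eq_vec_def intro!: mult_left_mono_neg fill_mono)
  qed
  then show ?thesis
    using assms(3) by (auto simp: residual_def vfill_def intro!: sum_mono)
qed

text \<open>Supplies subsolutions for every right-hand side: all slots but slot 0 are empty.\<close>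

lemma residual_of_negative:
  assumes "\<And>i j. i \<in> {1..<k} \<Longrightarrow> 0 \<le> d i $ j" "t \<le> 0"
  shows "residual k M d t = t"
proof -
  have nn: "0 \<le> (\<Sum>m = 1..<i. d m $ j)" if "i \<le> k" for i j
    using assms(1) that by (intro sum_nonneg) auto
  have "vfill k d i t = 0" if "i \<in> {1..k}" for i
  proof -
    have "fill k (\<lambda>m. d m $ j) i (t $ j) = 0" for j
    proof -
      have "t $ j \<le> 0" using assms(2) by (simp add: less_eq_vec_def)
      then show ?thesis using that nn[of i j] by (simp add: fill_def)
    qed
    then show ?thesis by (simp add: vec_eq_iff vfill_def)
  qed
  moreover have "vfill k d 0 t = - t"
    using assms(2) by (auto simp: vec_eq_iff vfill_def fill_def less_eq_vec_def max_def intro: antisym)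
  ultimately show ?thesis by (simp add: residual_def)
qed

lemma residual_solution:
  assumes "\<And>i. i \<in> {1..k} \<Longrightarrow> Z_matrix (M i)"
    and "a \<le> b" "residual k M d a \<le> p" "p \<le> residual k M d b"
  obtains t where "a \<le> t" "t \<le> b" "residual k M d t = p"
  using offdiag_antitone_box_solution[OF continuous_on_residual residual_antitone] assms by metis

section \<open>From \<open>SSM_W\<close> to unique solvability\<close>

lemma EHLCP_le:
  assumes M0: "M 0 = mat 1" and Z: "\<And>i. i \<in> {1..k} \<Longrightarrow> Z_matrix (M i)"
    and S: "SSM_W k M" and d: "\<And>i. i \<in> {1..<k} \<Longrightarrow> pos_vec (d i)"
    and x: "x \<in> EHLCP k M d q" and x': "x' \<in> EHLCP k M d q" and i: "i \<in> {1..k}"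
  shows "x i \<le> x' i"
proof -
  define y where "y m = (\<chi> j. max 0 (x m $ j - x' m $ j))" for m
  define z where "z m = (\<chi> j. max 0 (x' m $ j - x m $ j))" for m
  \<comment> \<open>Entry 0 is not a positive part but the value that the homogeneous equation
    dictates.\<close>
  define y' where "y' = y(0 := (\<Sum>m = 1..k. M m *v y m))"
  have nn: "0 \<le> y m" "0 \<le> z m" for m by (auto simp: y_def z_def less_eq_vec_def)
  have y: "y m = x m - x' m + z m" for m by (auto simp: vec_eq_iff y_def z_def)
  have eq: "x 0 - x' 0 = (\<Sum>m = 1..k. M m *v (x m - x' m))"
    using x x' M0 by (simp add: EHLCP_def matrix_vector_mult_diff_distrib sum_subtractf)
  \<comment> \<open>If one slot of \<open>x\<close> exceeds that of \<open>x'\<close> at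
    \<open>j\<close>, the chains are ordered there. So all negative parts \<open>z\<close> vanish at
    \<open>j\<close>, and the Z-property makes their contribution nonpositive.\<close>
  have neg: "y' 0 $ j \<le> 0" if m: "m \<in> {1..k}" and pos: "0 < y m $ j" for m j
  proof -
    have lt: "x' m $ j < x m $ j" using pos by (simp add: y_def max_def split: if_splits)
    note cmp = complementary_chain_comparison
      [of k "\<lambda>i. d i $ j" "\<lambda>i. x' i $ j" "\<lambda>i. x i $ j" m, OF _ _ _ _ _ m lt]
    have "x' l $ j \<le> x l $ j" if "l \<in> {1..k}" for l
      using x x' d that by (intro cmp(1)) (auto simp: EHLCP_def pos_vec_def vec_eq_iff inf_vec_def)
    then have z0: "z l $ j = 0" if "l \<in> {1..k}" for l
      using that by (simp add: z_def)
    have "x 0 $ j \<le> x' 0 $ j"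
      using x x' d by (intro cmp(2)) (auto simp: EHLCP_def pos_vec_def vec_eq_iff inf_vec_def)
    moreover have "y' 0 = (x 0 - x' 0) + (\<Sum>l = 1..k. M l *v z l)"
      unfolding eq y'_def y by (simp add: matrix_vector_right_distrib sum.distrib)
    moreover have "(\<Sum>l = 1..k. M l *v z l) $ j \<le> 0"
      unfolding sum_component by (intro sum_nonpos Z_matrix_mult_nonpos Z nn(2) z0)
    ultimately show ?thesis by simp
  qed
  have "M 0 *v y' 0 = (\<Sum>m = 1..k. M m *v y' m)"
    using M0 by (simp add: y'_def)
  moreover have "0 \<le> y' m \<and> y' 0 * y' m \<le> 0" if m: "m \<in> {1..k}" for m
  proof
    show "0 \<le> y' m" using m nn by (simp add: y'_def)
    have "y' 0 $ j * y m $ j \<le> 0" for j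
      using neg[OF m, of j] nn(1)[of m]
      by (cases "y m $ j = 0") (auto simp: less_eq_vec_def less_le intro!: mult_nonpos_nonneg)
    then show "y' 0 * y' m \<le> 0" using m by (simp add: less_eq_vec_def y'_def)
  qed
  ultimately have "\<forall>m\<in>{0..k}. y' m = 0"
    using S unfolding SSM_W_def by blast
  then have "y i = 0" using i by (auto simp: y'_def dest: bspec[of _ _ i])
  then have y0: "max 0 (x i $ j - x' i $ j) = 0" for j by (simp add: y_def vec_eq_iff)
  have "x i $ j \<le> x' i $ j" for j using y0[of j] by linarith
  then show ?thesis by (simp add: less_eq_vec_def)
qed

lemma EHLCP_unique:
  assumes "M 0 = mat 1" "\<And>i. i \<in> {1..k} \<Longrightarrow> Z_matrix (M i)"
    and "SSM_W k M" "\<And>i. i \<in> {1..<k} \<Longrightarrow> pos_vec (d i)"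
    and x: "x \<in> EHLCP k M d q" and x': "x' \<in> EHLCP k M d q"
  shows "x = x'"
proof -
  have eq: "x i = x' i" if "i \<in> {1..k}" for i
    using EHLCP_le[of M, OF assms(1-4) x x' that] EHLCP_le[of M, OF assms(1-4) x' x that]
    by (rule antisym)
  then have "x 0 = x' 0" using x x' assms(1) by (simp add: EHLCP_def)
  then have "x i = x' i" if "i \<in> {0..k}" for i using eq[of i] that by (cases "i = 0") auto
  then show ?thesis using x x' unfolding EHLCP_def by (blast intro: PiE_ext)
qed

text \<open>Only the last matrix matters for large \<open>t\<close>, where all further mass enters
  slot \<open>k\<close>. The test tuple puts \<open>s\<close> into that slot alone.\<close>

lemma SSM_W_last_semipositive:
  assumes "M 0 = mat 1" "k \<ge> 1" "Z_matrix (M k)" "SSM_W k M"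
  shows "semipositive (M k)"
proof (rule no_nonneg_descent_imp_semipositive[OF assms(3)])
  show "no_nonneg_descent (M k)"
    unfolding no_nonneg_descent_def
  proof (intro allI impI)
    fix s :: "real ^ 'a" assume s: "0 \<le> s" "M k *v s \<le> 0"
    define x where "x i = (if i = 0 then M k *v s else if i = k then s else 0)" for i
    have "(\<Sum>i = 1..k. M i *v x i) = (\<Sum>i = 1..k. if i = k then M k *v s else 0)"
      by (intro sum.cong) (auto simp: x_def)
    then have "M 0 *v x 0 = (\<Sum>i = 1..k. M i *v x i)"
      using assms(1,2) by (simp add: x_def)
    moreover have "0 \<le> x i \<and> x 0 * x i \<le> 0" if "i \<in> {1..k}" for i
      using that s by (auto simp: x_def less_eq_vec_def mult_nonpos_nonneg)
    ultimately have "\<forall>i\<in>{0..k}. x i = 0" using assms(4) unfolding SSM_W_def by blast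
    then show "s = 0" using assms(2) by (auto simp: x_def dest: bspec[of _ _ k])
  qed
qed

lemma EHLCP_exists:
  assumes M0: "M 0 = mat 1" and k: "k \<ge> 1" and Z: "\<And>i. i \<in> {1..k} \<Longrightarrow> Z_matrix (M i)"
    and S: "SSM_W k M" and d: "\<And>i. i \<in> {1..<k} \<Longrightarrow> pos_vec (d i)"
  shows "\<exists>x. x \<in> EHLCP k M d q"
proof -
  obtain u where u: "\<And>j. 0 < u $ j" "\<And>j. 0 < (M k *v u) $ j"
    using SSM_W_last_semipositive[OF M0 k Z S] k by (auto simp: semipositive_def pos_vec_def)
  define e where "e = (\<Sum>i = 1..<k. M i *v d i)"
  \<comment> \<open>The least \<open>N \<ge> 0\<close> with
    \<open>- q \<le> e + N *\<^sub>R (M k *v u)\<close>.\<close>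
  define N where "N = Max (range (\<lambda>j. max 0 (- q $ j - e $ j) / (M k *v u) $ j))"
  have N_ge: "max 0 (- q $ j - e $ j) / (M k *v u) $ j \<le> N" for j
    unfolding N_def by (rule Max_ge) auto
  have N: "0 \<le> N" "- q $ j - e $ j \<le> N * (M k *v u) $ j" for j
  proof -
    have "0 \<le> max 0 (- q $ j - e $ j) / (M k *v u) $ j"
      using u(2)[of j] by (intro divide_nonneg_pos) auto
    then show "0 \<le> N" using N_ge[of j] by linarith
    have "max 0 (- q $ j - e $ j) \<le> N * (M k *v u) $ j"
      using N_ge[of j] u(2)[of j] by (simp add: pos_divide_le_eq)
    then show "- q $ j - e $ j \<le> N * (M k *v u) $ j" by simp
  qed
  have d0: "0 \<le> d m $ j" if "m \<in> {1..<k}" for m j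
    using d[OF that] by (simp add: pos_vec_def less_imp_le)
  \<comment> \<open>Fills every capacity exactly and leaves \<open>N *\<^sub>R u\<close> for slot
    \<open>k\<close>, so the residual is \<open>e + N *\<^sub>R (M k *v u)\<close>.\<close>
  define b where "b = (\<Sum>m = 1..<k. d m) + N *\<^sub>R u"
  have fb: "vfill k d i b = (if i = 0 then 0 else if i < k then d i else N *\<^sub>R u)"
    if "i \<le> k" for i
  proof -
    have Nu: "0 \<le> N * u $ j" for j using N(1) u(1)[of j] by simp
    have "fill k (\<lambda>m. d m $ j) i (b $ j) = (if i = 0 then 0 else if i < k then d i $ j else N * u $ j)" for j
    proof -
      consider "i = 0" | "i = k" "i \<noteq> 0" | "i \<noteq> 0" "i < k" using \<open>i \<le> k\<close> by linarith
      then show ?thesis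
      proof cases
        case 1
        have "0 \<le> (\<Sum>m = 1..<k. d m $ j)" using d0 by (intro sum_nonneg) auto
        then have "0 \<le> b $ j" using Nu[of j] by (simp add: b_def)
        then show ?thesis using 1 by (simp add: fill_def)
      next
        case 2
        then show ?thesis using Nu[of j] by (simp add: fill_def b_def)
      next
        case 3
        have "(\<Sum>m = 1..<i. d m $ j) + d i $ j = (\<Sum>m = 1..<Suc i. d m $ j)" using 3 by simp
        also have "\<dots> \<le> (\<Sum>m = 1..<k. d m $ j)" using d0 3 by (intro sum_mono2) auto
        also have "\<dots> \<le> b $ j" using Nu[of j] by (simp add: b_def)
        finally show ?thesis using 3 d0[of i j] by (simp add: fill_def)
      qed
    qed
    then show ?thesis by (simp add: vec_eq_iff vfill_def)
  qed
  have "(\<Sum>i = 1..k. M i *v vfill k d i b) = (\<Sum>i = 1..<k. M i *v vfill k d i b) + M k *v vfill k d k b"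
    using k by (simp add: sum.last_plus add.commute)
  also have "\<dots> = e + N *\<^sub>R (M k *v u)"
    using k by (simp add: fb e_def matrix_vector_mult_scaleR)
  finally have "residual k M d b = e + N *\<^sub>R (M k *v u)" by (simp add: residual_def fb)
  moreover have "- q $ j \<le> e $ j + N * (M k *v u) $ j" for j using N(2)[of j] by simp
  ultimately have super: "- q \<le> residual k M d b" by (simp add: less_eq_vec_def)
  define a where "a = (\<chi> j. - \<bar>q $ j\<bar>)"
  have a: "a \<le> 0" "a \<le> - q" by (auto simp: a_def less_eq_vec_def)
  have "residual k M d a = a" using d0 a(1) by (intro residual_of_negative)
  then have sub: "residual k M d a \<le> - q" using a by simp
  have "0 \<le> b"
    using d0 N(1) u(1) by (auto simp: b_def less_eq_vec_def less_imp_le intro!: add_nonneg_nonneg sum_nonneg)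
  then have "a \<le> b" using a by simp
  then obtain t where "residual k M d t = - q"
    using residual_solution[of k M, OF Z _ sub super] by blast
  then show ?thesis using vfill_EHLCP[of M k d t q] M0 k d by blast
qed

section \<open>From uniqueness to \<open>SSM_W\<close>\<close>

text \<open>By antitonicity the minimum \<open>w\<close> of \<open>t\<close> and \<open>t'\<close>
  is a supersolution for the value at \<open>t\<close>. Some solution \<open>v\<close> lies below
  it, and uniqueness gives \<open>v = t\<close>.\<close>

lemma unique_imp_residual_inverse_isotone:
  assumes M0: "M 0 = mat 1" and k: "k \<ge> 1" and Z: "\<And>i. i \<in> {1..k} \<Longrightarrow> Z_matrix (M i)"
    and d: "\<And>i. i \<in> {1..<k} \<Longrightarrow> pos_vec (d i)"
    and U: "\<And>q x x'. x \<in> EHLCP k M d q \<Longrightarrow> x' \<in> EHLCP k M d q \<Longrightarrow> x = x'"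
    and le: "residual k M d t \<le> residual k M d t'"
  shows "t \<le> t'"
proof -
  define p where "p = residual k M d t"
  define w where "w = (\<chi> j. min (t $ j) (t' $ j))"
  have w: "w \<le> t" "w \<le> t'" by (auto simp: w_def less_eq_vec_def)
  have "p $ j \<le> residual k M d w $ j" for j
  proof (cases "t $ j \<le> t' $ j")
    case True
    then show ?thesis
      unfolding p_def by (intro residual_antitone Z w) (auto simp: w_def)
  next
    case False
    then have "residual k M d t' $ j \<le> residual k M d w $ j"
      by (intro residual_antitone Z w) (auto simp: w_def)
    then show ?thesis using le by (auto simp: p_def less_eq_vec_def intro: order_trans)
  qed
  then have super: "p \<le> residual k M d w" by (simp add: less_eq_vec_def)
  define a where "a = (\<chi> j. - (\<bar>t $ j\<bar> + \<bar>t' $ j\<bar> + \<bar>p $ j\<bar>))"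
  have a: "a \<le> 0" "a \<le> p" "a \<le> w" by (auto simp: a_def w_def less_eq_vec_def)
  have "residual k M d a = a"
    using d a(1) by (intro residual_of_negative) (auto simp: pos_vec_def less_imp_le)
  then have sub: "residual k M d a \<le> p" using a by simp
  obtain v where v: "v \<le> w" "residual k M d v = p"
    using residual_solution[of k M, OF Z a(3) sub super] by blast
  have "restrict (\<lambda>i. vfill k d i v) {0..k} = restrict (\<lambda>i. vfill k d i t) {0..k}"
    using v(2) by (intro U[of _ "- p"] vfill_EHLCP[of M, OF M0 k d]) (auto simp: p_def)
  then have "vfill k d i v = vfill k d i t" if "i \<le> k" for i
    using that by (metis atLeastAtMost_iff le0 restrict_apply')
  then have "v = t"
    using vfill_sum[of k d v, OF k d] vfill_sum[of k d t, OF k d] by simp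
  then show ?thesis using v(1) w(2) by simp
qed

lemma unique_imp_column_representative:
  fixes M :: "nat \<Rightarrow> real ^ 'n ^ 'n"
  assumes M0: "M 0 = mat 1" and k: "k \<ge> 1" and Z: "\<And>i. i \<in> {1..k} \<Longrightarrow> Z_matrix (M i)"
    and U: "\<And>d q x x'. (\<And>i. i \<in> {1..<k} \<Longrightarrow> pos_vec (d i)) \<Longrightarrow>
      x \<in> EHLCP k M d q \<Longrightarrow> x' \<in> EHLCP k M d q \<Longrightarrow> x = x'"
    and \<sigma>: "range \<sigma> \<subseteq> {1..k}"
  shows "no_nonneg_descent (\<chi> r j. M (\<sigma> j) $ r $ j)"
  unfolding no_nonneg_descent_def
proof (intro allI impI)
  fix s :: "real ^ 'n"
  assume s: "0 \<le> s" and As: "(\<chi> r j. M (\<sigma> j) $ r $ j) *v s \<le> 0"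
  \<comment> \<open>Equal capacities exceeding \<open>s\<close>, and \<open>t\<close> exactly fills
    the slots before \<open>\<sigma> j\<close>. Adding \<open>s\<close> then changes slot
    \<open>\<sigma> j\<close> only, without overflow, so the residual changes by the representative
    matrix times \<open>s\<close>.\<close>
  define d :: "nat \<Rightarrow> real ^ 'n" where "d = (\<lambda>_. s + vec 1)"
  define t where "t = (\<chi> j. real (\<sigma> j - 1) * (s $ j + 1))"
  have s0: "0 \<le> s $ j" for j using s by (simp add: less_eq_vec_def)
  have \<sigma>': "1 \<le> \<sigma> j" "\<sigma> j \<le> k" for j
    using subsetD[OF \<sigma> rangeI, of j] by auto
  have d: "pos_vec (d i)" for i using s0 by (simp add: d_def pos_vec_def add_nonneg_pos)
  have t0: "0 \<le> t $ j" for j using s0 by (simp add: t_def)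
  have step: "fill k (\<lambda>m. d m $ j) i ((t + s) $ j) - fill k (\<lambda>m. d m $ j) i (t $ j)
      = (if i = \<sigma> j then s $ j else 0)" if i: "i \<in> {1..k}" for i j
  proof -
    define c where "c = s $ j + 1"
    have c: "0 < c" "s $ j < c" using s0[of j] by (auto simp: c_def)
    have sum: "(\<Sum>m = 1..<i. d m $ j) = real (i - 1) * c" by (simp add: d_def c_def)
    have tj: "t $ j = real (\<sigma> j - 1) * c" by (simp add: t_def c_def)
    consider "i < \<sigma> j" | "i = \<sigma> j" | "\<sigma> j < i" by linarith
    then show ?thesis
    proof cases
      case 1
      then have "real (i - 1) + 1 \<le> real (\<sigma> j - 1)" using i by auto
      then have "(real (i - 1) + 1) * c \<le> t $ j" using c tj by (simp add: mult_right_mono)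
      then have "c \<le> t $ j - real (i - 1) * c" by (simp add: algebra_simps)
      then show ?thesis
        using 1 i \<sigma>'(2)[of j] c s0[of j] sum by (simp add: fill_def d_def c_def)
    next
      case 2
      then show ?thesis
        using i c s0[of j] sum tj by (auto simp: fill_def d_def c_def)
    next
      case 3
      then have "real (\<sigma> j - 1) + 1 \<le> real (i - 1)" using \<sigma>'(1)[of j] by auto
      then have "(real (\<sigma> j - 1) + 1) * c \<le> real (i - 1) * c" using c by (simp add: mult_right_mono)
      then have "t $ j + c \<le> real (i - 1) * c" by (simp add: tj algebra_simps)
      then show ?thesis
        using 3 i c s0[of j] sum by (auto simp: fill_def d_def)
    qed
  qed
  have step': "vfill k d i (t + s) - vfill k d i t = (\<chi> j. if i = \<sigma> j then s $ j else 0)"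
    if "i \<in> {1..k}" for i
    using step[OF that] by (simp add: vec_eq_iff vfill_def)
  have "vfill k d 0 (t + s) = vfill k d 0 t"
  proof -
    have "max 0 (- (t $ j + s $ j)) = max 0 (- t $ j)" for j using t0[of j] s0[of j] by linarith
    then show ?thesis by (simp add: vec_eq_iff vfill_def fill_def)
  qed
  then have "residual k M d (t + s) - residual k M d t
      = (\<Sum>i = 1..k. M i *v (vfill k d i (t + s) - vfill k d i t))"
    by (simp add: residual_def matrix_vector_mult_diff_distrib sum_subtractf)
  also have "\<dots> = (\<Sum>i = 1..k. M i *v (\<chi> j. if i = \<sigma> j then s $ j else 0))"
    using step' by simp
  also have "\<dots> = (\<chi> r j. M (\<sigma> j) $ r $ j) *v s"
  proof -
    have "(\<Sum>i = 1..k. M i $ r $ j * (if i = \<sigma> j then s $ j else 0)) = M (\<sigma> j) $ r $ j * s $ j"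
      for r j
      using \<sigma>'[of j] by (simp add: if_distrib[of "(*) _"] cong: if_cong)
    then show ?thesis
      unfolding vec_eq_iff matrix_vector_mult_def sum_component vec_lambda_beta
      by (subst sum.swap) simp
  qed
  finally have "residual k M d (t + s) - residual k M d t \<le> 0" using As by simp
  then have le: "residual k M d (t + s) \<le> residual k M d t" by (simp add: less_eq_vec_def)
  have "t + s \<le> t"
    by (rule unique_imp_residual_inverse_isotone[of M k d, OF M0 k Z d U[OF d] le])
  then have "s \<le> 0" by (simp add: less_eq_vec_def)
  then show "s = 0" using s by (rule antisym)
qed

lemma unique_imp_SSM_W:
  fixes M :: "nat \<Rightarrow> real ^ 'n ^ 'n"
  assumes M0: "M 0 = mat 1" and k: "k \<ge> 1" and Z: "\<And>i. i \<in> {1..k} \<Longrightarrow> Z_matrix (M i)"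
    and U: "\<And>d q x x'. (\<And>i. i \<in> {1..<k} \<Longrightarrow> pos_vec (d i)) \<Longrightarrow>
      x \<in> EHLCP k M d q \<Longrightarrow> x' \<in> EHLCP k M d q \<Longrightarrow> x = x'"
  shows "SSM_W k M"
  unfolding SSM_W_def
proof (intro allI impI)
  fix x :: "nat \<Rightarrow> real ^ 'n"
  assume "M 0 *v x 0 = (\<Sum>i = 1..k. M i *v x i) \<and> (\<forall>i\<in>{1..k}. 0 \<le> x i \<and> x 0 * x i \<le> 0)"
  then have x0: "x 0 = (\<Sum>i = 1..k. M i *v x i)"
    and nn: "\<And>i j. i \<in> {1..k} \<Longrightarrow> 0 \<le> x i $ j"
    and opp: "\<And>i j. i \<in> {1..k} \<Longrightarrow> x 0 $ j * x i $ j \<le> 0"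
    using M0 by (auto simp: less_eq_vec_def)
  define s where "s = (\<Sum>i = 1..k. x i)"
  \<comment> \<open>Share of slot \<open>i\<close> in the total at \<open>j\<close>; where the total
    is 0, slot 1 gets weight 1 so that the weights still sum to 1.\<close>
  define w where "w i j = (if s $ j = 0 then if i = 1 then 1 else 0 else x i $ j / s $ j)" for i j
  define A where "A = (\<chi> r j. \<Sum>i\<in>{1..k}. w i j * M i $ r $ j)"
  have s: "0 \<le> s" using nn by (auto simp: s_def less_eq_vec_def intro!: sum_nonneg)
  have s_zero: "s $ j = 0 \<longleftrightarrow> (\<forall>i\<in>{1..k}. x i $ j = 0)" for j
    unfolding s_def sum_component using nn by (intro sum_nonneg_eq_0_iff) auto
  have w0: "0 \<le> w i j" if "i \<in> {1..k}" for i j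
    using that nn s by (simp add: w_def less_eq_vec_def)
  have w1: "(\<Sum>i = 1..k. w i j) = 1" for j
  proof (cases "s $ j = 0")
    case True
    then show ?thesis using k by (simp add: w_def)
  next
    case False
    then have "(\<Sum>i = 1..k. w i j) = s $ j / s $ j"
      by (simp add: w_def s_def flip: sum_divide_distrib)
    then show ?thesis using False by simp
  qed
  have "semipositive A"
    unfolding A_def
  proof (rule semipositive_column_mixture[OF _ w0 w1])
    fix \<sigma> :: "'n \<Rightarrow> nat" assume \<sigma>: "range \<sigma> \<subseteq> {1..k}"
    have "Z_matrix (\<chi> r j. M (\<sigma> j) $ r $ j)"
      using Z \<sigma> unfolding Z_matrix_def by (auto simp: subset_iff)
    then show "semipositive (\<chi> r j. M (\<sigma> j) $ r $ j)"
      by (rule no_nonneg_descent_imp_semipositive)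
        (rule unique_imp_column_representative[of M, OF M0 k Z U \<sigma>])
  qed auto
  moreover have ZA: "Z_matrix A"
    using Z w0 by (auto simp: A_def Z_matrix_def intro!: sum_nonpos mult_nonneg_nonpos)
  ultimately have E: "no_nonneg_descent A" by (intro semipositive_imp_no_nonneg_descent)
  have As: "A *v s = x 0"
  proof -
    have ws: "w i j * s $ j = x i $ j" if "i \<in> {1..k}" for i j
      using that s_zero[of j] by (simp add: w_def)
    have "(\<Sum>i = 1..k. w i j * M i $ r $ j) * s $ j = (\<Sum>i = 1..k. M i $ r $ j * x i $ j)" for r j
      unfolding sum_distrib_right by (intro sum.cong refl) (simp add: ws[symmetric] mult_ac)
    then show ?thesis
      unfolding x0 A_def vec_eq_iff matrix_vector_mult_def sum_component vec_lambda_beta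
      by (subst sum.swap) simp
  qed
  \<comment> \<open>Where \<open>s\<close> vanishes this is the Z-property of \<open>A\<close>;
    elsewhere some \<open>x i\<close> is positive and the Hadamard condition fixes the sign.\<close>
  have "x 0 $ j \<le> 0" for j
  proof (cases "s $ j = 0")
    case True
    then show ?thesis using Z_matrix_mult_nonpos[OF ZA s] As by simp
  next
    case False
    then obtain i where "i \<in> {1..k}" "0 < x i $ j" using s_zero[of j] nn by (metis less_le)
    then show ?thesis using opp[of i j] by (simp add: mult_le_0_iff)
  qed
  then have "s = 0" using E s As by (simp add: no_nonneg_descent_def less_eq_vec_def)
  then have xi: "x i = 0" if "i \<in> {1..k}" for i using s_zero that by (simp add: vec_eq_iff)
  moreover have "x 0 = 0" using As \<open>s = 0\<close> by simp
  ultimately show "\<forall>i\<in>{0..k}. x i = 0" by (metis atLeastAtMost_iff le0 less_one not_le)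
qed

section \<open>Transfer from \<open>M 0 = mat 1\<close> to an invertible \<open>C 0\<close>\<close>

theorem corollary4p8:
  fixes C :: "nat \<Rightarrow> real ^ 'n ^ 'n" and k :: nat
  assumes "k \<ge> 1"
    and "invertible (C 0)"
    and "\<And>i. i \<in> {1..k} \<Longrightarrow> Z_matrix (matrix_inv (C 0) ** C i)"
  shows "SSM_W k C \<longleftrightarrow>
    (\<forall>(q :: real ^ 'n) (d :: nat \<Rightarrow> real ^ 'n).
      (\<forall>j \<in> {1..<k}. pos_vec (d j)) \<longrightarrow> (\<exists>!x. x \<in> EHLCP k C d q))"
proof -
  define D where "D = matrix_inv (C 0)"
  define M where "M i = D ** C i" for i
  have "C 0 ** D = mat 1 \<and> D ** C 0 = mat 1"
    unfolding D_def matrix_inv_def by (rule someI_ex[OF assms(2)[unfolded invertible_def]])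
  then have DC: "D ** C 0 = mat 1" "C 0 ** D = mat 1" by auto
  then have M0: "M 0 = mat 1" by (simp add: M_def)
  have Z: "Z_matrix (M i)" if "i \<in> {1..k}" for i using assms(3)[OF that] by (simp add: M_def D_def)
  have D_inj: "D *v y = D *v z \<longleftrightarrow> y = z" for y z
    using DC(2) by (metis matrix_vector_mul_assoc matrix_vector_mul_lid)
  have sum: "(\<Sum>i = 1..k. M i *v x i) = D *v (\<Sum>i = 1..k. C i *v x i)" for x
    by (simp add: M_def linear_sum[OF matrix_vector_mul_linear] flip: matrix_vector_mul_assoc)
  have eq: "C 0 *v x 0 = q + (\<Sum>i = 1..k. C i *v x i) \<longleftrightarrow>
      M 0 *v x 0 = D *v q + (\<Sum>i = 1..k. M i *v x i)" for q x
    unfolding sum matrix_vector_right_distrib[symmetric]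
    by (simp add: M_def D_inj flip: matrix_vector_mul_assoc)
  have EHLCP: "EHLCP k C d q = EHLCP k M d (D *v q)" for d q
    unfolding EHLCP_def eq ..
  \<comment> \<open>The homogeneous case \<open>q = 0\<close> of the same equivalence.\<close>
  have SSM: "SSM_W k C = SSM_W k M"
    using eq[of _ 0] by (simp add: SSM_W_def)
  have surj: "q = D *v (C 0 *v q)" for q
    by (simp add: matrix_vector_mul_assoc DC)
  \<comment> \<open>By \<open>surj\<close>, every right-hand side for \<open>M\<close> comes from
    one for \<open>C\<close>, so uniqueness carries over to all \<open>q\<close>.\<close>
  show ?thesis
  proof
    assume S: "SSM_W k C"
    show "\<forall>q d. (\<forall>j\<in>{1..<k}. pos_vec (d j)) \<longrightarrow> (\<exists>!x. x \<in> EHLCP k C d q)"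
    proof (intro allI impI)
      fix q :: "real ^ 'n" and d :: "nat \<Rightarrow> real ^ 'n"
      assume "\<forall>j\<in>{1..<k}. pos_vec (d j)"
      then have d: "\<And>j. j \<in> {1..<k} \<Longrightarrow> pos_vec (d j)" by blast
      show "\<exists>!x. x \<in> EHLCP k C d q"
        unfolding EHLCP
        by (rule ex_ex1I[OF EHLCP_exists[of M k d, OF M0 assms(1) Z S[unfolded SSM] d]
              EHLCP_unique[of M k d, OF M0 Z S[unfolded SSM] d]])
    qed
  next
    assume R: "\<forall>q d. (\<forall>j\<in>{1..<k}. pos_vec (d j)) \<longrightarrow> (\<exists>!x. x \<in> EHLCP k C d q)"
    have U: "x = x'" if "\<And>i. i \<in> {1..<k} \<Longrightarrow> pos_vec (d i)" "x \<in> EHLCP k M d q" "x' \<in> EHLCP k M d q"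
      for d q x x'
    proof -
      have "\<exists>!x. x \<in> EHLCP k M d (D *v (C 0 *v q))"
        using R that(1) unfolding EHLCP by blast
      then show ?thesis using that(2,3) unfolding surj[symmetric] by blast
    qed
    show "SSM_W k C" unfolding SSM by (rule unique_imp_SSM_W[of M k, OF M0 assms(1) Z U])
  qed
qed

end
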